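(* Let $\rho>1$, $\hat\sigma_{\mathrm w}^2>0$, $P_{\mathrm b},P_{\mathrm c}\ge 0$, $\mathbf h_{\mathrm{rw}},\mathbf h_{\mathrm{AR}}\in\mathbb C^{M\times 1}$, and let $\boldsymbol\Theta_{\mathrm r}$ be a reflection coefficient matrix of the STAR-RIS. Set $\phi_1=P_{\mathrm c}\left|\mathbf h_{\mathrm{rw}}^H\boldsymbol\Theta_{\mathrm r}\mathbf h_{\mathrm{AR}}\right|^2$ and $\phi_2=(P_{\mathrm b}+P_{\mathrm c})\left|\mathbf h_{\mathrm{rw}}^H\boldsymbol\Theta_{\mathrm r}\mathbf h_{\mathrm{AR}}\right|^2$. Then, among detection thresholds $\tau_{\mathrm{dt}}\in\left[\frac{\hat\sigma_{\mathrm w}^2}{\rho}+\phi_1,\ \rho\hat\sigma_{\mathrm w}^2+\phi_1\right]$, the detection error probability $P_{\mathrm e}$ at Willie (as a function of $\tau_{\mathrm{dt}}$) is minimized at $$\tau_{\mathrm{dt}}^*=\min\left\{\phi_2+\frac{\hat\sigma_{\mathrm w}^2}{\rho},\ \phi_1+\rho\hat\sigma_{\mathrm w}^2\right\}.$$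
   Context: Setting: a single-antenna transmitter (Alice) serves a covert user (Bob) with power $P_{\mathrm b}$ and a public user (Carol) with power $P_{\mathrm c}$, aided by a STAR-RIS with $M$ elements. The vectors $\mathbf h_{\mathrm{AR}}$ and $\mathbf h_{\mathrm{rw}}$ are the channels from Alice to the STAR-RIS and from the STAR-RIS to the warden Willie; Willie knows them, so they are treated as fixed. The reflection coefficient matrix is $\boldsymbol\Theta_{\mathrm r}=\operatorname{Diag}\{\sqrt{\beta_{\mathrm r}^1}e^{\mathrm j\phi_{\mathrm r}^1},\ldots,\sqrt{\beta_{\mathrm r}^M}e^{\mathrm j\phi_{\mathrm r}^M}\}$ with $\beta_{\mathrm r}^m\in[0,1]$ and $\phi_{\mathrm r}^m\in[0,2\pi)$. Noise uncertainty: Willie's noise power $\sigma_{\mathrm w}^2$ is a random variable with density $f_{\sigma_{\mathrm w}^2}(x)=\frac{1}{2x\ln\rho}$ for $\frac{\hat\sigma_{\mathrm w}^2}{\rho}\le x\le\rho\hat\sigma_{\mathrm w}^2$ and $0$ otherwise, where $\rho>1$ is the uncertainty parameter and $\hat\sigma_{\mathrm w}^2>0$ is the nominal noise power. Detection: Willie distinguishes the hypotheses $\mathcal H_0$ (only the public signal is sent) and $\mathcal H_1$ (both the public and the covert signals are sent). Under an infinite number of samples, the average received power is $\overline P_{\mathrm w}=\phi_1+\sigma_{\mathrm w}^2$ under $\mathcal H_0$ and $\overline P_{\mathrm w}=\phi_2+\sigma_{\mathrm w}^2$ under $\mathcal H_1$. Willie decides for $\mathcal H_1$ (decision $\mathcal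 D_1$) if $\overline P_{\mathrm w}>\tau_{\mathrm{dt}}$ and for $\mathcal H_0$ (decision $\mathcal D_0$) if $\overline P_{\mathrm w}<\tau_{\mathrm{dt}}$. The detection error probability (DEP) is the sum of the false alarm and miss detection probabilities: $$P_{\mathrm e}=\Pr(\mathcal D_1\mid\mathcal H_0)+\Pr(\mathcal D_0\mid\mathcal H_1)=\Pr(\sigma_{\mathrm w}^2>\tau_{\mathrm{dt}}-\phi_1)+\Pr(\sigma_{\mathrm w}^2<\tau_{\mathrm{dt}}-\phi_2).$$ *)

theory Defs
  imports "HOL-Probability.Probability"
begin

definition diag_matrix :: "('m \<Rightarrow> complex) \<Rightarrow> complex ^ 'm ^ 'm" where
  "diag_matrix d = (\<chi> i j. if i = j then d i else 0)"

definition reflection_matrix :: "complex ^ 'm ^ 'm \<Rightarrow> bool" where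
  "reflection_matrix \<Theta> \<longleftrightarrow>
     (\<exists>\<beta> \<phi> :: 'm \<Rightarrow> real.
        (\<forall>m. 0 \<le> \<beta> m \<and> \<beta> m \<le> 1) \<and>
        (\<forall>m. 0 \<le> \<phi> m \<and> \<phi> m < 2 * pi) \<and>
        \<Theta> = diag_matrix (\<lambda>m. complex_of_real (sqrt (\<beta> m)) * exp (\<i> * complex_of_real (\<phi> m))))"

(* The cascaded channel h_rw^H \<Theta> h_AR. The library product on complex ^ 'm
   that is available here is real-valued, hence the explicit sum. *)
definition cascaded_channel ::
    "complex ^ 'm::finite \<Rightarrow> complex ^ 'm ^ 'm \<Rightarrow> complex ^ 'm \<Rightarrow> complex" where
  "cascaded_channel hrw \<Theta> hAR = (\<Sum>i\<in>UNIV. cnj (hrw $ i) * (\<Theta> *v hAR) $ i)"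

definition signal_power ::
    "real \<Rightarrow> complex ^ 'm::finite \<Rightarrow> complex ^ 'm ^ 'm \<Rightarrow> complex ^ 'm \<Rightarrow> real" where
  "signal_power P hrw \<Theta> hAR = P * (cmod (cascaded_channel hrw \<Theta> hAR))\<^sup>2"

definition noise_density :: "real \<Rightarrow> real \<Rightarrow> real \<Rightarrow> real" where
  "noise_density \<rho> \<sigma>2 x =
     (if \<sigma>2 / \<rho> \<le> x \<and> x \<le> \<rho> * \<sigma>2 then 1 / (2 * x * ln \<rho>) else 0)"

(* N is the noise power sigma_w^2, a random variable on the probability space \<Omega>;
   the average received power is \<phi> + N when the received signal power is \<phi>. *)
definition false_alarm_prob :: "'a measure \<Rightarrow> ('a \<Rightarrow> real) \<Rightarrow> real \<Rightarrow> real \<Rightarrow> real" where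
  "false_alarm_prob \<Omega> N \<phi>1 \<tau> = measure \<Omega> {\<omega> \<in> space \<Omega>. \<phi>1 + N \<omega> > \<tau>}"

definition miss_detection_prob :: "'a measure \<Rightarrow> ('a \<Rightarrow> real) \<Rightarrow> real \<Rightarrow> real \<Rightarrow> real" where
  "miss_detection_prob \<Omega> N \<phi>2 \<tau> = measure \<Omega> {\<omega> \<in> space \<Omega>. \<phi>2 + N \<omega> < \<tau>}"

definition detection_error_prob ::
    "'a measure \<Rightarrow> ('a \<Rightarrow> real) \<Rightarrow> real \<Rightarrow> real \<Rightarrow> real \<Rightarrow> real" where
  "detection_error_prob \<Omega> N \<phi>1 \<phi>2 \<tau> =
     false_alarm_prob \<Omega> N \<phi>1 \<tau> + miss_detection_prob \<Omega> N \<phi>2 \<tau>"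

end

theory Submission
  imports Defs
begin

text \<open>
  If \<open>\<phi>1 \<le> \<phi>2\<close>, the detection error probability at \<open>\<tau>\<close> is one minus the probability that the
  noise power lies in the window \<open>[\<tau> - \<phi>2, \<tau> - \<phi>1]\<close> of fixed length. The noise density vanishes below
  \<open>\<sigma>2 / \<rho>\<close> and decreases from there on, so a window starting at \<open>\<sigma>2 / \<rho>\<close> has the largest
  probability. If such a window exceeds the support, the threshold \<open>\<phi>1 + \<rho> * \<sigma>2\<close> already
  captures the whole support.
\<close>

text \<open>If \<open>t \<le> a\<close>, the part of the window below \<open>a\<close> contributes
  nothing and the rest lies in \<open>{a..a + d}\<close>. If \<open>t > a\<close>, translation by
  \<open>t - a\<close> carries \<open>{a..a + d}\<close> onto the window and moves each point to the
  right inside \<open>{a..}\<close>, where \<open>f\<close> can only drop.\<close>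

lemma nn_integral_window_le:
  fixes f :: "real \<Rightarrow> ennreal"
  assumes [measurable]: "f \<in> borel_measurable borel"
    and anti: "antimono_on {a..} f"
    and zero: "\<And>x. x < a \<Longrightarrow> f x = 0"
  shows "(\<integral>\<^sup>+x. f x * indicator {t..t + d} x \<partial>lborel) \<le> (\<integral>\<^sup>+x. f x * indicator {a..a + d} x \<partial>lborel)"
proof (cases "t \<le> a")
  case True
  then show ?thesis
    by (intro nn_integral_mono) (auto split: split_indicator intro: zero)
next
  case False
  have "(\<integral>\<^sup>+x. f x * indicator {t..t + d} x \<partial>lborel)
      = (\<integral>\<^sup>+x. f ((t - a) + 1 * x) * indicator {t..t + d} ((t - a) + 1 * x) \<partial>lborel)"
    by (subst nn_integral_real_affine[where c = 1 and t = "t - a"]) auto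
  also have "\<dots> \<le> (\<integral>\<^sup>+x. f x * indicator {a..a + d} x \<partial>lborel)"
    using False
    by (intro nn_integral_mono) (auto split: split_indicator intro!: monotone_onD[OF anti])
  finally show ?thesis .
qed

lemma (in prob_space) prob_window_le:
  fixes f :: "real \<Rightarrow> real"
  assumes N: "distributed M lborel N (\<lambda>x. ennreal (f x))"
    and anti: "antimono_on {a..} f"
    and zero: "\<And>x. x < a \<Longrightarrow> f x = 0"
  shows "\<P>(\<omega> in M. N \<omega> \<in> {t..t + d}) \<le> \<P>(\<omega> in M. N \<omega> \<in> {a..a + d})"
proof -
  have prob_eq: "emeasure M {\<omega> \<in> space M. N \<omega> \<in> {u..v}} = (\<integral>\<^sup>+x. ennreal (f x) * indicator {u..v} x \<partial>lborel)"
    for u v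
    using distributed_emeasure[OF N, of "{u..v}"] by (simp add: vimage_def Int_def conj_commute)
  have "antimono_on {a..} (\<lambda>x. ennreal (f x))"
    using anti by (auto simp: monotone_on_def intro!: ennreal_leI)
  moreover have "(\<lambda>x. ennreal (f x)) \<in> borel_measurable borel"
    using distributed_borel_measurable[OF N] by simp
  ultimately have "emeasure M {\<omega> \<in> space M. N \<omega> \<in> {t..t + d}} \<le> emeasure M {\<omega> \<in> space M. N \<omega> \<in> {a..a + d}}"
    unfolding prob_eq by (intro nn_integral_window_le) (auto simp: zero)
  then show ?thesis
    by (simp add: emeasure_eq_measure)
qed

text \<open>Since \<open>\<phi>1 \<le> \<phi>2\<close>, no noise value causes both errors, so the
  two probabilities add up to that of a union. Both error events are strict, hence the complementary
  window is closed.\<close>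

lemma (in prob_space) detection_error_prob_eq:
  assumes [measurable]: "N \<in> borel_measurable M" and "\<phi>1 \<le> \<phi>2"
  shows "detection_error_prob M N \<phi>1 \<phi>2 \<tau> = 1 - \<P>(\<omega> in M. N \<omega> \<in> {\<tau> - \<phi>2..\<tau> - \<phi>1})"
proof -
  let ?F = "{\<omega> \<in> space M. \<phi>1 + N \<omega> > \<tau>}" and ?D = "{\<omega> \<in> space M. \<phi>2 + N \<omega> < \<tau>}"
  have "detection_error_prob M N \<phi>1 \<phi>2 \<tau> = prob (?F \<union> ?D)"
    unfolding detection_error_prob_def false_alarm_prob_def miss_detection_prob_def
    using assms(2) by (subst finite_measure_Union) auto
  also have "?F \<union> ?D = space M - {\<omega> \<in> space M. N \<omega> \<in> {\<tau> - \<phi>2..\<tau> - \<phi>1}}"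
    by auto
  also have "prob \<dots> = 1 - \<P>(\<omega> in M. N \<omega> \<in> {\<tau> - \<phi>2..\<tau> - \<phi>1})"
    by (subst prob_compl) auto
  finally show ?thesis .
qed

text \<open>On the support the density is a positive multiple of \<open>1 / x\<close>, and past
  \<open>\<rho> * \<sigma>2\<close> it drops to 0. The jump upwards at
  \<open>\<sigma>2 / \<rho>\<close> forces the restriction to a half-line.\<close>

lemma antimono_on_noise_density:
  assumes "\<rho> > 1" and "\<sigma>2 > 0"
  shows "antimono_on {\<sigma>2 / \<rho>..} (noise_density \<rho> \<sigma>2)"
proof (rule monotone_onI)
  fix x y assume xy: "x \<in> {\<sigma>2 / \<rho>..}" "y \<in> {\<sigma>2 / \<rho>..}" "x \<le> y"
  have "0 < \<sigma>2 / \<rho>" "0 < ln \<rho>"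
    using assms by auto
  with xy have "0 < x" "0 < y"
    by auto
  with xy \<open>0 < ln \<rho>\<close> show "noise_density \<rho> \<sigma>2 x \<ge> noise_density \<rho> \<sigma>2 y"
    unfolding noise_density_def by (auto intro!: divide_left_mono mult_right_mono mult_pos_pos)
qed

text \<open>This permits cutting a window off at \<open>\<rho> * \<sigma>2\<close> without loss of
  probability.\<close>

lemma AE_noise_le:
  assumes N: "distributed M lborel N (\<lambda>x. ennreal (noise_density \<rho> \<sigma>2 x))"
  shows "AE \<omega> in M. N \<omega> \<le> \<rho> * \<sigma>2"
proof -
  have [measurable]: "(\<lambda>x. ennreal (noise_density \<rho> \<sigma>2 x)) \<in> borel_measurable lborel"
    using distributed_borel_measurable[OF N] .
  have "AE x in distr M lborel N. x \<le> \<rho> * \<sigma>2"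
    unfolding distributed_distr_eq_density[OF N] by (subst AE_density) (auto simp: noise_density_def)
  then show ?thesis
    using distributed_measurable[OF N] by (subst (asm) AE_distr_iff) auto
qed

theorem theorem1:
  fixes \<rho> \<sigma>2 Pb Pc \<phi>1 \<phi>2 :: real
    and hrw hAR :: "complex ^ 'm::finite"
    and \<Theta> :: "complex ^ 'm ^ 'm"
    and \<Omega> :: "'a measure" and N :: "'a \<Rightarrow> real"
  assumes "\<rho> > 1" and "\<sigma>2 > 0" and "Pb \<ge> 0" and "Pc \<ge> 0"
    and "reflection_matrix \<Theta>"
    and "prob_space \<Omega>"
    and "distributed \<Omega> lborel N (\<lambda>x. ennreal (noise_density \<rho> \<sigma>2 x))"
    and "\<phi>1 = signal_power Pc hrw \<Theta> hAR"
    and "\<phi>2 = signal_power (Pb + Pc) hrw \<Theta> hAR"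
  shows "is_arg_min (detection_error_prob \<Omega> N \<phi>1 \<phi>2)
           (\<lambda>\<tau>. \<tau> \<in> {\<sigma>2 / \<rho> + \<phi>1 .. \<rho> * \<sigma>2 + \<phi>1})
           (min (\<phi>2 + \<sigma>2 / \<rho>) (\<phi>1 + \<rho> * \<sigma>2))"
proof -
  interpret prob_space \<Omega>
    by fact
  let ?a = "\<sigma>2 / \<rho>" and ?b = "\<rho> * \<sigma>2"
  let ?\<tau> = "min (\<phi>2 + ?a) (\<phi>1 + ?b)"
  note N = assms(7)
  have [measurable]: "N \<in> borel_measurable \<Omega>"
    using distributed_measurable[OF N] by simp
  have le: "\<phi>1 \<le> \<phi>2"
    using assms(3) by (simp add: assms(8,9) signal_power_def mult_right_mono)
  \<comment> \<open>This is \<open>?a \<le> ?b\<close> multiplied by \<open>\<rho>\<close>.\<close>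
  have "1 * \<sigma>2 \<le> \<rho> * \<rho> * \<sigma>2"
    using assms(1,2) by (intro mult_right_mono) (auto intro: less_1_mult less_imp_le)
  then have ab: "?a \<le> ?b"
    using assms(1) by (simp add: field_simps)
  have opt: "\<P>(\<omega> in \<Omega>. N \<omega> \<in> {\<tau> - \<phi>2..\<tau> - \<phi>1}) \<le> \<P>(\<omega> in \<Omega>. N \<omega> \<in> {?\<tau> - \<phi>2..?\<tau> - \<phi>1})" for \<tau>
  proof -
    have "\<P>(\<omega> in \<Omega>. N \<omega> \<in> {\<tau> - \<phi>2..\<tau> - \<phi>1}) \<le> \<P>(\<omega> in \<Omega>. N \<omega> \<in> {?a..?a + (\<phi>2 - \<phi>1)})"
      using prob_window_le[OF N antimono_on_noise_density[OF assms(1,2)],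
          of "\<tau> - \<phi>2" "\<phi>2 - \<phi>1"]
      by (simp add: noise_density_def)
    \<comment> \<open>By the choice of \<open>?\<tau>\<close>, the right-hand window starts at or
      below \<open>?a\<close> and ends at the smaller of \<open>?a + (\<phi>2 - \<phi>1)\<close> and
      \<open>?b\<close>. It thus misses only values above \<open>?b\<close>, which form a null
      event.\<close>
    also have "\<dots> \<le> \<P>(\<omega> in \<Omega>. N \<omega> \<in> {?\<tau> - \<phi>2..?\<tau> - \<phi>1})"
      using AE_noise_le[OF N] by (intro finite_measure_mono_AE) (auto elim!: eventually_mono)
    finally show ?thesis .
  qed
  show ?thesis
    \<comment> \<open>\<open>opt\<close> holds for every real threshold; \<open>le\<close> and
      \<open>ab\<close> put \<open>?\<tau>\<close> at or above the lower end
      \<open>?a + \<phi>1\<close> of the admissible interval.\<close>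
    using opt le ab
    by (auto simp: is_arg_min_def detection_error_prob_eq not_less)
qed

end
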